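(* Let $n,s\in\mathbb{N}_0=\{0,1,2,\dots\}$ and let $\nu$ be real. If $\nu>n-1$, then all the zeros of the polynomial $$x\mapsto {}_3F_3\left(-s,\frac{\nu+1}{2},\frac{\nu}{2}+1;\ \nu+1,\frac{\nu-n+1}{2},\frac{\nu-n}{2}+1;\ x\right)$$ are real and simple.
   Context: Here ${}_pF_q(a_1,\dots,a_p;b_1,\dots,b_q;x)=\sum_{m\ge0}\frac{(a_1)_m\cdots(a_p)_m}{(b_1)_m\cdots(b_q)_m}\frac{x^m}{m!}$ is the generalized hypergeometric series, with $(a)_m=a(a+1)\cdots(a+m-1)$, $(a)_0=1$. Since $-s$ is a nonpositive integer, the series terminates and is a polynomial in $x$ of degree at most $s$. "All zeros" refers to zeros in the complex plane. *)

theory Defs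
  imports Complex_Main "HOL-Computational_Algebra.Computational_Algebra"
begin

end

theory Submission
  imports Defs "HOL-Real_Asymp.Real_Asymp"
begin

text \<open>
  Writing \<open>b = \<nu> - n + 1 > 0\<close>, the coefficients of the series are those of
  \<open>1F1(-s; \<nu> + 1; x)\<close> multiplied by \<open>(b + 2m)\<^sub>n / (b)\<^sub>n\<close>. With \<open>\<theta> = x d/dx\<close>, the
  polynomial is therefore obtained from \<open>1F1(-s; \<nu> + 1; x)\<close>, a Laguerre polynomial, by applying
  the operators \<open>2\<theta> + b + i\<close> for \<open>i < n\<close>. The Laguerre polynomials themselves arise from the
  constant \<open>1\<close> by the operators \<open>\<theta> + a - x\<close>. Up to a positive factor, \<open>(\<theta> + a - k x) g\<close> is the
  derivative of \<open>x\<^sup>a exp(- k x) g(x)\<close>, which vanishes at \<open>0\<close>, at the positive zeros of \<open>g\<close> and, when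
  \<open>k > 0\<close>, at infinity. By Rolle's theorem all these operators preserve the property of having as
  many distinct positive zeros as the degree.
\<close>

section \<open>Rolle's theorem for finitely many zeros and for decay at infinity\<close>

text \<open>Zeros are added in increasing order, so Rolle is applied between the old maximum and the
  new zero. The clause \<open>\<exists>z\<in>Z. w < z\<close> keeps earlier points below that
  maximum, which makes the new point distinct. The derivative is taken only on the open half-line
  because \<open>x powr a\<close> may fail to have one at 0.\<close>

lemma Rolle_finite_set:
  fixes f f' :: "real \<Rightarrow> real"
  assumes "finite Z" and "Z \<subseteq> {c..}" and "continuous_on {c..} f"
    and deriv: "\<And>x. x > c \<Longrightarrow> (f has_real_derivative f' x) (at x)"
    and "\<And>z. z \<in> Z \<Longrightarrow> f z = 0"
  shows "\<exists>W. finite W \<and> card Z \<le> Suc (card W) \<and> W \<subseteq> {c<..} \<and>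
             (\<forall>w\<in>W. f' w = 0 \<and> (\<exists>z\<in>Z. w < z))"
  using assms(1,2,5)
proof (induction Z rule: finite_linorder_max_induct)
  case empty
  show ?case by (intro exI[of _ "{}"]) auto
next
  case (insert b A)
  show ?case
  proof (cases "A = {}")
    case True
    then show ?thesis by (intro exI[of _ "{}"]) auto
  next
    case False
    obtain W where W: "finite W" "card A \<le> Suc (card W)" "W \<subseteq> {c<..}"
      "\<And>w. w \<in> W \<Longrightarrow> f' w = 0 \<and> (\<exists>z\<in>A. w < z)"
      using insert by auto
    define M where "M = Max A"
    have M: "M \<in> A" "\<And>z. z \<in> A \<Longrightarrow> z \<le> M"
      using False insert.hyps by (auto simp: M_def)
    have "M < b" "c \<le> M" using M insert by auto
    have "\<exists>z. M < z \<and> z < b \<and> DERIV f z :> 0"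
    proof (rule Rolle)
      show "f M = f b" using M insert.prems by simp
      show "continuous_on {M..b} f"
        using assms(3) by (rule continuous_on_subset) (use \<open>c \<le> M\<close> in auto)
      show "f differentiable (at x)" if "M < x" "x < b" for x
        using deriv[of x] that \<open>c \<le> M\<close> by (auto simp: real_differentiable_def)
    qed fact
    then obtain z where z: "M < z" "z < b" "DERIV f z :> 0" by auto
    have "f' z = 0"
      using DERIV_unique[OF deriv z(3)] z(1) \<open>c \<le> M\<close> by auto
    have "z \<notin> W" using W(4) M z by force
    have "card (insert b A) = Suc (card A)" using insert.hyps by auto
    then show ?thesis
      using W z \<open>z \<notin> W\<close> \<open>f' z = 0\<close> \<open>c \<le> M\<close>
      by (intro exI[of _ "insert z W"]) auto
  qed
qed

lemma Rolle_at_top: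
  fixes f f' :: "real \<Rightarrow> real"
  assumes cont: "continuous_on {c..} f"
    and deriv: "\<And>x. x > c \<Longrightarrow> (f has_real_derivative f' x) (at x)"
    and "f c = 0" and lim: "(f \<longlongrightarrow> 0) at_top"
  shows "\<exists>z>c. f' z = 0"
proof (cases "\<exists>y>c. f y = 0")
  case True
  then obtain y where y: "y > c" "f y = 0" by auto
  obtain W where W: "finite W" "card {c,y} \<le> Suc (card W)" "W \<subseteq> {c<..}" "\<forall>w\<in>W. f' w = 0"
    using Rolle_finite_set[of "{c,y}" c f f'] assms y by force
  have "W \<noteq> {}" using W(2) y by auto
  then show ?thesis using W by auto
next
  case False
  \<comment> \<open>Squaring spares the distinction between positive and negative \<open>f\<close>.\<close>
  define g where "g x = (f x)\<^sup>2" for x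
  have g: "(g has_real_derivative 2 * f x * f' x) (at x)" if "x > c" for x
    unfolding g_def using deriv[OF that] by (auto intro!: derivative_eq_intros)
  have contg: "continuous_on {c..} g"
    unfolding g_def using cont by (intro continuous_intros)
  have pos: "g x > 0" if "x > c" for x using False that by (auto simp: g_def)
  have "(g \<longlongrightarrow> 0\<^sup>2) at_top" unfolding g_def by (intro tendsto_intros lim)
  then have "eventually (\<lambda>x. g x < g (c + 1)) at_top"
    using pos[of "c + 1"] by (intro order_tendstoD) auto
  then have "eventually (\<lambda>x. g x < g (c + 1) \<and> x > c + 1) at_top"
    using eventually_gt_at_top[of "c + 1"] by eventually_elim auto
  then obtain y where y: "g y < g (c + 1)" "y > c + 1"
    by (auto simp: eventually_at_top_linorder)
  \<comment> \<open>Since \<open>g c = 0 < g y < g (c + 1)\<close>, the value \<open>g y\<close> is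
    already taken before \<open>c + 1\<close>; Rolle then applies to \<open>g\<close> between
    \<open>x\<close> and \<open>y\<close>.\<close>
  have "\<exists>x\<ge>c. x \<le> c + 1 \<and> g x = g y"
    using y pos[of y] \<open>f c = 0\<close>
    by (intro IVT' continuous_on_subset[OF contg]) (auto simp: g_def)
  then obtain x where x: "c \<le> x" "x \<le> c + 1" "g x = g y" by auto
  have "\<exists>z. x < z \<and> z < y \<and> DERIV g z :> 0"
  proof (rule Rolle)
    show "continuous_on {x..y} g"
      using contg by (rule continuous_on_subset) (use x in auto)
    show "g differentiable (at u)" if "x < u" "u < y" for u
      using g[of u] that x by (auto simp: real_differentiable_def)
  qed (use x y in auto)
  then obtain z where z: "x < z" "DERIV g z :> 0" by auto
  have "z > c" using x z by simp
  moreover have "f' z = 0"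
    using DERIV_unique[OF g z(2)] \<open>z > c\<close> False by auto
  ultimately show ?thesis by auto
qed

section \<open>Polynomials with only simple positive zeros\<close>

text \<open>Counting distinct zeros expresses simplicity without multiplicities and fits the counts
  that Rolle yields. The zero polynomial must be excluded: \<open>card\<close> of its infinite zero
  set is 0, which is also its degree.\<close>

definition pos_simple_rooted :: "real poly \<Rightarrow> bool" where
  "pos_simple_rooted p \<longleftrightarrow> p \<noteq> 0 \<and> card {x. x > 0 \<and> poly p x = 0} = degree p"

lemma pos_simple_rootedI:
  assumes "p \<noteq> 0" "finite A" "degree p \<le> card A" "\<And>x. x \<in> A \<Longrightarrow> x > 0 \<and> poly p x = 0"
  shows "pos_simple_rooted p"
proof -
  have fin: "finite {x. poly p x = 0}" using assms(1) by (rule poly_roots_finite)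
  have "card A \<le> card {x. x > 0 \<and> poly p x = 0}"
    by (rule card_mono[OF finite_subset[OF _ fin]]) (use assms in auto)
  moreover have "card {x. x > 0 \<and> poly p x = 0} \<le> card {x. poly p x = 0}"
    by (rule card_mono[OF fin]) auto
  moreover have "card {x. poly p x = 0} \<le> degree p"
    using assms(1) by (rule card_poly_roots_bound)
  ultimately show ?thesis using assms by (simp add: pos_simple_rooted_def)
qed

lemma pos_simple_rooted_smult:
  assumes "pos_simple_rooted p" "c \<noteq> 0"
  shows "pos_simple_rooted (smult c p)"
  using assms by (simp add: pos_simple_rooted_def)

section \<open>First-order operators preserving simple positive zeros\<close>

lemma tendsto_powr_exp_poly_at_top:
  fixes p :: "real poly"
  assumes "k > 0"
  shows "((\<lambda>x. x powr a * exp (- k * x) * poly p x) \<longlongrightarrow> 0) at_top"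
proof -
  have "((\<lambda>x. x powr a * exp (- k * x) * (coeff p i * x ^ i)) \<longlongrightarrow> 0) at_top" for i
  proof -
    have "((\<lambda>x. x powr a * exp (- k * x) * x ^ i) \<longlongrightarrow> 0) at_top"
      using assms by real_asymp
    from tendsto_mult_right_zero[OF this, of "coeff p i"] show ?thesis
      by (simp add: mult_ac)
  qed
  then have "((\<lambda>x. \<Sum>i\<le>degree p. x powr a * exp (- k * x) * (coeff p i * x ^ i)) \<longlongrightarrow> 0) at_top"
    by (intro tendsto_null_sum)
  then show ?thesis by (simp add: poly_altdef sum_distrib_left)
qed

text \<open>The case distinction stops the truncated \<open>m - 1\<close> from picking up
  \<open>coeff p 0\<close> at \<open>m = 0\<close>.\<close>

lemma coeff_euler_operator:
  fixes p :: "real poly"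
  shows "coeff ([:a, -k:] * p + [:0, 1:] * pderiv p) m =
           (a + real m) * coeff p m - (if m = 0 then 0 else k * coeff p (m - 1))"
  by (cases m) (auto simp: coeff_pderiv algebra_simps)

text \<open>Together with 0, the zeros of \<open>p\<close> give \<open>degree p + 1\<close> zeros of
  \<open>f\<close>, hence \<open>degree p\<close> zeros of the derivative. This suffices for
  \<open>k = 0\<close>, where the degree does not grow. For \<open>k > 0\<close> the degree may grow
  by one, and decay at infinity supplies the missing zero.\<close>

lemma pos_simple_rooted_euler_operator:
  assumes p: "pos_simple_rooted p" and "a > 0" "k \<ge> 0"
  shows "pos_simple_rooted ([:a, -k:] * p + [:0, 1:] * pderiv p)" (is "pos_simple_rooted ?h")
proof -
  define Z where "Z = {x. x > 0 \<and> poly p x = 0}"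
  have "p \<noteq> 0" and card: "card Z = degree p"
    using p by (auto simp: pos_simple_rooted_def Z_def)
  have fin: "finite Z"
    using poly_roots_finite[OF \<open>p \<noteq> 0\<close>] by (rule finite_subset[rotated]) (auto simp: Z_def)
  define f where "f x = x powr a * exp (- k * x) * poly p x" for x
  define f' where "f' x = x powr (a - 1) * exp (- k * x) * poly ?h x" for x
  have f: "(f has_real_derivative f' x) (at x)" if "x > 0" for x
  proof -
    have "x powr a = x * x powr (a - 1)"
      using that by (simp add: powr_diff)
    then show ?thesis
      unfolding f_def f'_def using that
      by (auto intro!: derivative_eq_intros poly_DERIV simp: algebra_simps)
  qed
  have cont: "continuous_on {0..} f"
    unfolding f_def using \<open>a > 0\<close>
    by (intro continuous_intros continuous_on_powr') auto
  have root: "x > 0 \<Longrightarrow> f' x = 0 \<Longrightarrow> poly ?h x = 0" for x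
    by (simp only: f'_def mult_eq_0_iff powr_eq_0_iff exp_not_eq_zero) auto
  have coeffs: "coeff ?h m = (a + real m) * coeff p m - (if m = 0 then 0 else k * coeff p (m - 1))"
    for m by (rule coeff_euler_operator)
  have f0: "f z = 0" if "z \<in> insert 0 Z" for z
    using that \<open>a > 0\<close> by (auto simp: f_def Z_def)
  have "insert 0 Z \<subseteq> {0..}" by (auto simp: Z_def)
  from Rolle_finite_set[OF finite.insertI[OF fin] this cont f f0]
  obtain W where W: "finite W" "card (insert 0 Z) \<le> Suc (card W)" "W \<subseteq> {0<..}"
    "\<And>w. w \<in> W \<Longrightarrow> f' w = 0 \<and> (\<exists>z\<in>insert 0 Z. w < z)"
    by metis
  have cardW: "degree p \<le> card W"
    using W(2) fin card by (simp add: Z_def card_insert_if split: if_splits)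
  show ?thesis
  proof (cases "k = 0")
    case True
    have "?h \<noteq> 0"
    proof
      assume "?h = 0"
      then have "coeff ?h (degree p) = 0" by (simp only: coeff_0)
      then have "(a + real (degree p)) * lead_coeff p = 0" unfolding coeffs using True by simp
      moreover have "a + real (degree p) \<noteq> 0" using \<open>a > 0\<close> by linarith
      ultimately show False using \<open>p \<noteq> 0\<close> by simp
    qed
    moreover have "degree ?h \<le> degree p"
    proof (rule degree_le, intro allI impI)
      fix i assume "degree p < i"
      then show "coeff ?h i = 0" unfolding coeffs using True by (simp add: coeff_eq_0)
    qed
    ultimately show ?thesis
      using W cardW root by (intro pos_simple_rootedI[of _ W]) auto
  next
    case False
    define M where "M = Max (insert 0 Z)"
    have "M \<in> insert 0 Z" unfolding M_def using fin by (intro Max_in) auto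
    have M: "z \<le> M" if "z \<in> insert 0 Z" for z
      using that fin by (simp only: M_def) auto
    have "M \<ge> 0" using M by auto
    have "\<exists>z>M. f' z = 0"
    proof (rule Rolle_at_top)
      show "continuous_on {M..} f"
        using cont by (rule continuous_on_subset) (use \<open>M \<ge> 0\<close> in auto)
      show "(f \<longlongrightarrow> 0) at_top"
        unfolding f_def using False \<open>k \<ge> 0\<close> by (intro tendsto_powr_exp_poly_at_top) auto
    qed (use f f0 \<open>M \<in> insert 0 Z\<close> \<open>M \<ge> 0\<close> in auto)
    then obtain y where y: "y > M" "f' y = 0" by auto
    \<comment> \<open>Every point of \<open>W\<close> lies below some element of
      \<open>insert 0 Z\<close>, hence below \<open>M\<close>.\<close>
    have "y \<notin> W" using W(4) M y(1) by force
    have "?h \<noteq> 0"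
    proof
      assume "?h = 0"
      then have "coeff ?h (Suc (degree p)) = 0" by (simp only: coeff_0)
      then show False unfolding coeffs using False \<open>p \<noteq> 0\<close> by (simp add: coeff_eq_0)
    qed
    moreover have "degree ?h \<le> Suc (degree p)"
    proof (rule degree_le, intro allI impI)
      fix i assume "Suc (degree p) < i"
      then show "coeff ?h i = 0" unfolding coeffs by (simp add: coeff_eq_0)
    qed
    ultimately show ?thesis
      using W cardW root y \<open>y \<notin> W\<close> \<open>M \<ge> 0\<close>
      by (intro pos_simple_rootedI[of _ "insert y W"]) auto
  qed
qed

section \<open>Laguerre polynomials and Pochhammer multipliers\<close>

text \<open>The operator with parameters \<open>a\<close> and \<open>k = 1\<close> sends 1F1(-s;
  a+1; x) to \<open>a\<close> times 1F1(-s-1; a; x). Raising \<open>s\<close> thus lowers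
  \<open>a\<close>, so the induction must generalize over \<open>a\<close>.\<close>

lemma laguerre_pos_simple_rooted:
  assumes "a > 0"
  shows "\<exists>p. pos_simple_rooted p \<and>
             (\<forall>m. coeff p m = pochhammer (- real s) m / (pochhammer a m * fact m))"
  using assms
proof (induction s arbitrary: a)
  case 0
  have "coeff 1 m = pochhammer (- real 0) m / (pochhammer a m * fact m)" for m
    by (cases m) (auto simp: pochhammer_0_left)
  moreover have "pos_simple_rooted 1" by (simp add: pos_simple_rooted_def)
  ultimately show ?case by blast
next
  case (Suc s)
  obtain p where p: "pos_simple_rooted p"
    "\<And>m. coeff p m = pochhammer (- real s) m / (pochhammer (a + 1) m * fact m)"
    using Suc.IH[of "a + 1"] Suc.prems by auto
  define h where "h = [:a, -1:] * p + [:0, 1:] * pderiv p"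
  have "coeff (smult (1 / a) h) m = pochhammer (- real (Suc s)) m / (pochhammer a m * fact m)" for m
  proof (cases m)
    case 0
    then show ?thesis
      unfolding h_def coeff_smult coeff_euler_operator p(2) using Suc.prems by simp
  next
    case (Suc j)
    have nz: "pochhammer (a + 1) j > 0" "a + 1 + real j > 0"
      using \<open>a > 0\<close> by (auto intro!: pochhammer_pos)
    have 1: "pochhammer (- real (Suc s)) (Suc j) = - (1 + real s) * pochhammer (- real s) j"
      by (simp add: pochhammer_rec)
    have 2: "pochhammer a (Suc j) = a * pochhammer (a + 1) j"
      by (simp add: pochhammer_rec)
    have "coeff h m = (a + real m) * coeff p m - coeff p j"
      unfolding h_def coeff_euler_operator using Suc by simp
    \<comment> \<open>With \<open>m = j + 1\<close>, the factor \<open>a + m\<close> cancels the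
      last factor of \<open>pochhammer (a + 1) m\<close>; the numerator left over is
      \<open>(j - s) - (j + 1) = - (s + 1)\<close>.\<close>
    also have "\<dots> = a * (- (1 + real s) * pochhammer (- real s) j /
                          (a * pochhammer (a + 1) j * fact (Suc j)))"
      unfolding p(2) Suc pochhammer_Suc using nz \<open>a > 0\<close>
      by (simp add: divide_simps) (simp add: algebra_simps)
    finally show ?thesis unfolding Suc 1 2 using \<open>a > 0\<close> by simp
  qed
  moreover have "pos_simple_rooted (smult (1 / a) h)"
    unfolding h_def using p Suc.prems
    by (intro pos_simple_rooted_smult pos_simple_rooted_euler_operator) auto
  ultimately show ?case by blast
qed

lemma pos_simple_rooted_pochhammer_multiplier:
  assumes p: "pos_simple_rooted p" and "b > 0"
  shows "\<exists>q. pos_simple_rooted q \<and> (\<forall>m. coeff q m = pochhammer (b + 2 * real m) k * coeff p m)"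
proof (induction k)
  case 0
  show ?case using p by auto
next
  case (Suc k)
  then obtain q where q: "pos_simple_rooted q"
    "\<And>m. coeff q m = pochhammer (b + 2 * real m) k * coeff p m" by auto
  \<comment> \<open>This multiplies the coefficient of index \<open>m\<close> by
    \<open>2 * ((b + k) / 2 + m) = b + 2 * m + k\<close>, the next Pochhammer factor.\<close>
  define h where "h = smult 2 ([:(b + real k) / 2, -0:] * q + [:0, 1:] * pderiv q)"
  have "coeff h m = pochhammer (b + 2 * real m) (Suc k) * coeff p m" for m
    unfolding h_def coeff_smult coeff_euler_operator q(2) pochhammer_Suc
    by (simp add: field_simps)
  moreover have "pos_simple_rooted h"
    unfolding h_def using q \<open>b > 0\<close>
    by (intro pos_simple_rooted_smult pos_simple_rooted_euler_operator) auto
  ultimately show ?case by blast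
qed

section \<open>Complex zeros and the hypergeometric polynomial\<close>

text \<open>The real zeros already exhaust the degree, so there are no further complex ones. The
  orders sum to at most the degree, so one order above 1 would exceed it.\<close>

lemma pos_simple_rooted_complex_roots:
  assumes p: "pos_simple_rooted p" and z: "poly (map_poly of_real p) (z :: complex) = 0"
  shows "z \<in> \<real> \<and> order z (map_poly of_real p) = 1"
proof -
  define q :: "complex poly" where "q = map_poly of_real p"
  define A :: "complex set" where "A = of_real ` {x. x > 0 \<and> poly p x = 0}"
  have "p \<noteq> 0" using p by (simp add: pos_simple_rooted_def)
  then have "q \<noteq> 0" by (simp add: q_def map_poly_eq_0_iff)
  define R where "R = {x. poly q x = 0}"
  have "finite R" unfolding R_def using \<open>q \<noteq> 0\<close> by (rule poly_roots_finite)
  have "poly q (of_real x) = of_real (poly p x)" for x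
    unfolding q_def by (induction p) (auto simp: map_poly_pCons)
  then have "A \<subseteq> R" by (auto simp: A_def R_def)
  have "card A = degree q"
    using p unfolding A_def q_def
    by (subst card_image) (auto simp: pos_simple_rooted_def inj_on_def degree_map_poly)
  have ord: "order x q \<ge> 1" if "x \<in> R" for x
    using that \<open>q \<noteq> 0\<close> order_root[of q x] by (simp add: R_def)
  have "(\<Sum>x\<in>R. order x q) \<le> degree q"
    unfolding R_def using \<open>q \<noteq> 0\<close> by (rule sum_order_le_degree)
  have "z \<in> R" using z by (simp add: R_def q_def)
  have "card R \<le> degree q"
    unfolding R_def using \<open>q \<noteq> 0\<close> by (rule card_poly_roots_bound)
  then have "R = A"
    using \<open>A \<subseteq> R\<close> \<open>card A = degree q\<close> \<open>finite R\<close> by (metis card_seteq)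
  then have "z \<in> \<real>" using \<open>z \<in> R\<close> by (auto simp: A_def)
  moreover have "order z q \<le> 1"
  proof (rule ccontr)
    assume "\<not> order z q \<le> 1"
    then have "(\<Sum>x\<in>R. 1) < (\<Sum>x\<in>R. order x q)"
      using \<open>z \<in> R\<close> \<open>finite R\<close> ord by (intro sum_strict_mono_ex1) (auto simp: not_le)
    then show False
      using \<open>(\<Sum>x\<in>R. order x q) \<le> degree q\<close> \<open>R = A\<close> \<open>card A = degree q\<close> by simp
  qed
  ultimately show ?thesis using ord[OF \<open>z \<in> R\<close>] by (simp add: q_def)
qed

theorem theorem2:
  fixes n s :: nat and \<nu> :: real
  assumes "\<nu> > real n - 1"
  shows "\<exists>p :: complex poly.
           fps_of_poly p =
             fps_hypergeo
               [- of_nat s, of_real ((\<nu> + 1) / 2), of_real (\<nu> / 2 + 1)]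
               [of_real (\<nu> + 1), of_real ((\<nu> - real n + 1) / 2), of_real ((\<nu> - real n) / 2 + 1)]
               1 \<and>
           (\<forall>z. poly p z = 0 \<longrightarrow> z \<in> \<real> \<and> order z p = 1)"
proof -
  define b where "b = \<nu> - real n + 1"
  have "b > 0" and \<nu>: "\<nu> + 1 = b + real n" using assms by (auto simp: b_def)
  obtain l where l: "pos_simple_rooted l"
    "\<And>m. coeff l m = pochhammer (- real s) m / (pochhammer (\<nu> + 1) m * fact m)"
    using laguerre_pos_simple_rooted[of "\<nu> + 1" s] \<open>b > 0\<close> \<nu> by auto
  obtain q where q: "pos_simple_rooted q"
    "\<And>m. coeff q m = pochhammer (b + 2 * real m) n * coeff l m"
    using pos_simple_rooted_pochhammer_multiplier[OF l(1) \<open>b > 0\<close>] by blast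
  \<comment> \<open>The scaling makes the constant coefficient 1, as in the series.\<close>
  define p where "p = smult (1 / pochhammer b n) q"
  have p: "pos_simple_rooted p"
    unfolding p_def using q(1) pochhammer_pos[OF \<open>b > 0\<close>, of n]
    by (intro pos_simple_rooted_smult) auto
  have coeff_p: "coeff p m =
      pochhammer (- real s) m * pochhammer ((\<nu> + 1) / 2) m * pochhammer (\<nu> / 2 + 1) m /
      (pochhammer (\<nu> + 1) m * pochhammer ((\<nu> - real n + 1) / 2) m *
       pochhammer ((\<nu> - real n) / 2 + 1) m * fact m)" for m
  proof -
    \<comment> \<open>Duplication formula; it produces the half-integer spaced pairs of parameters,
      here above and in \<open>2\<close> below the fraction.\<close>
    have 1: "pochhammer (b + real n) (2 * m) =
        4 ^ m * pochhammer ((\<nu> + 1) / 2) m * pochhammer (\<nu> / 2 + 1) m"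
      using pochhammer_double[of "(\<nu> + 1) / 2" m]
      by (simp add: \<nu>[symmetric] power_mult add_divide_distrib add_ac)
    have halves: "(\<nu> - real n + 1) / 2 = b / 2" "(\<nu> - real n) / 2 + 1 = b / 2 + 1 / 2"
      by (simp_all add: b_def field_simps)
    have 2: "pochhammer b (2 * m) =
        4 ^ m * pochhammer ((\<nu> - real n + 1) / 2) m * pochhammer ((\<nu> - real n) / 2 + 1) m"
      unfolding halves using pochhammer_double[of "b / 2" m] by (simp add: power_mult)
    have pos: "pochhammer b n > 0" "pochhammer b (2 * m) > 0"
      using \<open>b > 0\<close> by (auto intro: pochhammer_pos)
    \<comment> \<open>Both sides are \<open>pochhammer b (n + 2 * m)\<close>, split after
      \<open>n\<close> and after \<open>2 * m\<close> factors.\<close>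
    have "pochhammer b n * pochhammer (b + real n) (2 * m) =
          pochhammer b (2 * m) * pochhammer (b + 2 * real m) n"
      using pochhammer_product'[of b n "2 * m"] pochhammer_product'[of b "2 * m" n]
      by (simp add: add.commute)
    then have "pochhammer (b + 2 * real m) n / pochhammer b n =
        pochhammer (b + real n) (2 * m) / pochhammer b (2 * m)"
      using pos by (simp add: divide_simps mult_ac)
    also have "\<dots> = pochhammer ((\<nu> + 1) / 2) m * pochhammer (\<nu> / 2 + 1) m /
        (pochhammer ((\<nu> - real n + 1) / 2) m * pochhammer ((\<nu> - real n) / 2 + 1) m)"
      unfolding 1 2 by simp
    finally have "pochhammer (b + 2 * real m) n / pochhammer b n * coeff l m =
        pochhammer ((\<nu> + 1) / 2) m * pochhammer (\<nu> / 2 + 1) m /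
        (pochhammer ((\<nu> - real n + 1) / 2) m * pochhammer ((\<nu> - real n) / 2 + 1) m) * coeff l m"
      by simp
    then show ?thesis by (simp add: p_def q(2) l(2) mult_ac)
  qed
  have "fps_of_poly (map_poly of_real p) =
      fps_hypergeo
        [- of_nat s, of_real ((\<nu> + 1) / 2), of_real (\<nu> / 2 + 1)]
        [of_real (\<nu> + 1), of_real ((\<nu> - real n + 1) / 2), of_real ((\<nu> - real n) / 2 + 1)]
        (1 :: complex)"
  proof (rule fps_ext)
    fix m
    show "fps_of_poly (map_poly of_real p) $ m =
      fps_hypergeo
        [- of_nat s, of_real ((\<nu> + 1) / 2), of_real (\<nu> / 2 + 1)]
        [of_real (\<nu> + 1), of_real ((\<nu> - real n + 1) / 2), of_real ((\<nu> - real n) / 2 + 1)]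
        (1 :: complex) $ m"
      by (simp add: coeff_map_poly coeff_p flip: pochhammer_of_real)
  qed
  with pos_simple_rooted_complex_roots[OF p] show ?thesis by blast
qed

end
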